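(* Let $\Psi_1=\left\langle\begin{pmatrix}1&1\\0&1\end{pmatrix},\begin{pmatrix}1&0\\4&1\end{pmatrix}\right\rangle^+$ and $\Psi_2=\left\langle\begin{pmatrix}1&4\\0&1\end{pmatrix},\begin{pmatrix}1&0\\4&1\end{pmatrix}\right\rangle^+$. For a positive integer $n$ and $i\in\{1,2\}$, let $\Psi_i/n$ denote the image of $\Psi_i$ under reduction $\mathrm{SL}(2,\mathbb{Z})\to\mathrm{SL}(2,\mathbb{Z}/n\mathbb{Z})$, and similarly $\mathrm{SL}(2,\mathbb{Z})/n$. Write $n=n_{\mathrm{odd}}\,n'$ with $n_{\mathrm{odd}}$ odd and $n'$ a power of $2$. Then for $i\in\{1,2\}$: (1) $\Psi_i/n\cong\Psi_i/n_{\mathrm{odd}}\times\Psi_i/n'$ (via the Chinese remainder isomorphism $\mathrm{SL}(2,\mathbb{Z}/n)\cong\mathrm{SL}(2,\mathbb{Z}/n_{\mathrm{odd}})\times\mathrm{SL}(2,\mathbb{Z}/n')$); (2) $\Psi_i/n_{\mathrm{odd}}=\mathrm{SL}(2,\mathbb{Z})/n_{\mathrm{odd}}$; (3) there is an exponent $e_i\geq1$ such that for all $k\geq e_i$, $\Psi_i/2^k$ is the full preimage of $\Psi_i/2^{e_i}$ under the reduction map $\mathrm{SL}(2,\mathbb{Z}/2^k)\to\mathrm{SL}(2,\mathbb{Z}/2^{e_i})$; (4) one may take $e_1=2$ and $e_2=4$.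
   Context: $\langle A_1,\dots,A_k\rangle^+$ is the monoid generated by the $A_i$ and the identity. *)

theory Defs
  imports "HOL-Analysis.Determinants" "HOL-Algebra.Group"
begin

(* The product is the matrix product **; the type-class product * on
   int^2^2 is componentwise and is never used. *)
inductive_set monoid_gen :: "(int^2^2) set \<Rightarrow> (int^2^2) set" for S :: "(int^2^2) set" where
  one: "mat 1 \<in> monoid_gen S"
| gen: "A \<in> S \<Longrightarrow> A \<in> monoid_gen S"
| mult: "A \<in> monoid_gen S \<Longrightarrow> B \<in> monoid_gen S \<Longrightarrow> A ** B \<in> monoid_gen S"

definition mat2 :: "int \<Rightarrow> int \<Rightarrow> int \<Rightarrow> int \<Rightarrow> int^2^2" where
  "mat2 a b c d = vector [vector [a, b], vector [c, d]]"

definition Psi1 :: "(int^2^2) set" where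
  "Psi1 = monoid_gen {mat2 1 1 0 1, mat2 1 0 4 1}"

definition Psi2 :: "(int^2^2) set" where
  "Psi2 = monoid_gen {mat2 1 4 0 1, mat2 1 0 4 1}"

definition SL2Z :: "(int^2^2) set" where
  "SL2Z = {A. det A = 1}"

(* Elements of Z/nZ are represented by the integers 0, ..., n - 1.  For m dvd n the
   map red m is thus also the reduction from matrices over Z/nZ to matrices over Z/mZ. *)
definition red :: "nat \<Rightarrow> int^2^2 \<Rightarrow> int^2^2" where
  "red n A = (\<chi> i j. (A $ i $ j) mod int n)"

(* Taking red n of the identity matters for n = 1, where the group is {0}. *)
definition SL2_mod :: "nat \<Rightarrow> (int^2^2) monoid" where
  "SL2_mod n =
     \<lparr>carrier = {A. (\<forall>i j. A $ i $ j \<in> {0..<int n}) \<and> det A mod int n = 1 mod int n},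
      monoid.mult = (\<lambda>A B. red n (A ** B)),
      one = red n (mat 1)\<rparr>"

definition image_mod :: "(int^2^2) set \<Rightarrow> nat \<Rightarrow> (int^2^2) monoid" where
  "image_mod \<Psi> n = (SL2_mod n)\<lparr>carrier := red n ` \<Psi>\<rparr>"

definition crt :: "nat \<Rightarrow> nat \<Rightarrow> int^2^2 \<Rightarrow> (int^2^2) \<times> (int^2^2)" where
  "crt a b A = (red a A, red b A)"

definition full_preimage_from :: "(int^2^2) set \<Rightarrow> nat \<Rightarrow> bool" where
  "full_preimage_from \<Psi> e \<longleftrightarrow>
     (\<forall>k\<ge>e. red (2 ^ k) ` \<Psi> =
        {A \<in> carrier (SL2_mod (2 ^ k)). red (2 ^ e) A \<in> red (2 ^ e) ` \<Psi>})"

end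

theory Submission
  imports Defs "HOL-Number_Theory.Cong"
begin

text \<open>
  Modulo \<open>n\<close> the powers of a unipotent generator realise every integer exponent, so the image of
  the monoid is closed under \<open>A \<mapsto> U A\<close> for all elementary \<open>U\<close> whose off-diagonal entry lies in
  \<open>s\<int>\<close> (upper) or \<open>t\<int>\<close> (lower). For odd \<open>n\<close> the steps \<open>s, t \<in> {1, 4}\<close> are units, so all elementary
  matrices occur and the Euclidean algorithm gives (2). For (1), raise the generators to a power
  that is \<open>1\<close> modulo one factor and \<open>0\<close> modulo the other. For (3) and (4), if \<open>a \<equiv> 1 (mod s t)\<close>
  then the product of \<open>(1 s; 0 1)\<close> and \<open>(1 0; (a - 1)/s 1)\<close> has upper left entry \<open>a\<close>; when \<open>a\<close> is
  invertible, further elementary factors adjust the off-diagonal entries to any multiples of \<open>s\<close>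
  and \<open>t\<close>, and the determinant fixes the last entry.
\<close>

subsection \<open>Two-by-two integer matrices and their reductions\<close>

lemma mat2_nth [simp]:
  "mat2 a b c d $ 1 $ 1 = a" "mat2 a b c d $ 1 $ 2 = b"
  "mat2 a b c d $ 2 $ 1 = c" "mat2 a b c d $ 2 $ 2 = d"
  by (simp_all add: mat2_def)

lemma mat2_cases: obtains a b c d where "A = mat2 a b c d"
proof
  show "A = mat2 (A$1$1) (A$1$2) (A$2$1) (A$2$2)"
    by (simp add: vec_eq_iff forall_2)
qed

lemma mat2_eq_iff: "mat2 a b c d = mat2 a' b' c' d' \<longleftrightarrow> a = a' \<and> b = b' \<and> c = c' \<and> d = d'"
  by (auto simp: vec_eq_iff forall_2)

lemma mat2_mult:
  "mat2 a b c d ** mat2 a' b' c' d' =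
   mat2 (a * a' + b * c') (a * b' + b * d') (c * a' + d * c') (c * b' + d * d')"
  by (simp add: vec_eq_iff forall_2 matrix_matrix_mult_def sum_2)

lemma mat2_one: "mat 1 = mat2 1 0 0 1"
  by (simp add: vec_eq_iff forall_2 mat_def)

lemma det_mat2: "det (mat2 a b c d) = a * d - b * c"
  by (simp add: det_2)

lemma red_mat2: "red n (mat2 a b c d) = mat2 (a mod int n) (b mod int n) (c mod int n) (d mod int n)"
  by (simp add: red_def vec_eq_iff forall_2)

lemma red_mat2_eq_iff:
  "red n (mat2 a b c d) = red n (mat2 a' b' c' d') \<longleftrightarrow>
   [a = a'] (mod int n) \<and> [b = b'] (mod int n) \<and> [c = c'] (mod int n) \<and> [d = d'] (mod int n)"
  by (simp add: red_mat2 mat2_eq_iff cong_def)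

lemma red_red: "m dvd n \<Longrightarrow> red m (red n A) = red m A"
  by (simp add: red_def vec_eq_iff mod_mod_cancel)

lemma red_mult_cong:
  assumes "red n A = red n A'" "red n B = red n B'"
  shows "red n (A ** B) = red n (A' ** B')"
  using assms
  by (cases A rule: mat2_cases; cases A' rule: mat2_cases;
      cases B rule: mat2_cases; cases B' rule: mat2_cases)
    (auto simp: red_mat2_eq_iff mat2_mult intro!: cong_add cong_mult)

lemma red_mult_red: "red n (red n A ** red n B) = red n (A ** B)"
  by (rule red_mult_cong) (simp_all add: red_red)

lemma det_red: "det (red n A) mod int n = det A mod int n"
  by (cases A rule: mat2_cases) (simp add: red_mat2 det_mat2, metis mod_diff_eq mod_mult_eq)

lemma carrier_SL2_mod_iff:
  "A \<in> carrier (SL2_mod n) \<longleftrightarrow>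
   (\<forall>i j. A $ i $ j \<in> {0..<int n}) \<and> [det A = 1] (mod int n)"
  by (simp add: SL2_mod_def cong_def)

lemma red_in_carrier:
  "n > 0 \<Longrightarrow> [det A = 1] (mod int n) \<Longrightarrow> red n A \<in> carrier (SL2_mod n)"
  unfolding carrier_SL2_mod_iff cong_def det_red by (simp add: red_def)

lemma red_carrier: "A \<in> carrier (SL2_mod n) \<Longrightarrow> red n A = A"
  by (simp add: carrier_SL2_mod_iff red_def vec_eq_iff)

lemma red_eq_coprime:
  assumes "coprime m n" "red m A = red m B" "red n A = red n B"
  shows "red (m * n) A = red (m * n) B"
  using assms
  by (cases A rule: mat2_cases; cases B rule: mat2_cases)
    (auto simp: red_mat2_eq_iff intro: coprime_cong_mult)

lemma red_crt_exists:
  assumes "coprime m n"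
  obtains C where "red m C = red m A" "red n C = red n B"
proof -
  have ex: "\<exists>x. [x = a] (mod int m) \<and> [x = b] (mod int n)" for a b
    using assms by (intro binary_chinese_remainder_int) simp
  obtain a b c d a' b' c' d' where "A = mat2 a b c d" "B = mat2 a' b' c' d'"
    by (metis mat2_cases)
  moreover obtain x y z w where
    "[x = a] (mod int m) \<and> [x = a'] (mod int n)" "[y = b] (mod int m) \<and> [y = b'] (mod int n)"
    "[z = c] (mod int m) \<and> [z = c'] (mod int n)" "[w = d] (mod int m) \<and> [w = d'] (mod int n)"
    using ex by metis
  ultimately show ?thesis
    by (intro that [of "mat2 x y z w"]) (simp_all add: red_mat2_eq_iff)
qed

subsection \<open>The Chinese remainder isomorphism\<close>

lemma crt_hom: "crt m n \<in> hom (SL2_mod (m * n)) (SL2_mod m \<times>\<times> SL2_mod n)" if "m > 0" "n > 0"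
proof (rule homI)
  fix A assume "A \<in> carrier (SL2_mod (m * n))"
  then have "[det A = 1] (mod int m * int n)"
    by (simp add: carrier_SL2_mod_iff)
  then have "[det A = 1] (mod int m)" "[det A = 1] (mod int n)"
    by (auto intro: cong_dvd_modulus)
  then show "crt m n A \<in> carrier (SL2_mod m \<times>\<times> SL2_mod n)"
    using that by (simp add: crt_def red_in_carrier)
next
  fix A B
  show "crt m n (A \<otimes>\<^bsub>SL2_mod (m * n)\<^esub> B) =
        crt m n A \<otimes>\<^bsub>SL2_mod m \<times>\<times> SL2_mod n\<^esub> crt m n B"
    by (simp add: crt_def SL2_mod_def red_red red_mult_red)
qed

lemma crt_inj_on: "coprime m n \<Longrightarrow> inj_on (crt m n) (carrier (SL2_mod (m * n)))"
  by (rule inj_onI) (metis crt_def prod.inject red_carrier red_eq_coprime)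

lemma crt_iso:
  assumes "coprime m n" "m > 0" "n > 0"
  shows "crt m n \<in> iso (SL2_mod (m * n)) (SL2_mod m \<times>\<times> SL2_mod n)"
proof -
  have "\<exists>C \<in> carrier (SL2_mod (m * n)). crt m n C = (A, B)"
    if A: "A \<in> carrier (SL2_mod m)" and B: "B \<in> carrier (SL2_mod n)" for A B
  proof -
    obtain C where C: "red m C = red m A" "red n C = red n B"
      using red_crt_exists assms(1) by blast
    \<comment> \<open>The determinant is a polynomial in the entries, so modulo \<open>m\<close> and
      \<open>n\<close> it agrees with that of \<open>A\<close> and \<open>B\<close>.\<close>
    have "[det C = 1] (mod int m)" "[det C = 1] (mod int n)"
      using A B C det_red unfolding carrier_SL2_mod_iff cong_def by metis+
    then have "[det C = 1] (mod int (m * n))"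
      using assms by (simp add: coprime_cong_mult)
    then have "red (m * n) C \<in> carrier (SL2_mod (m * n))"
      using assms by (intro red_in_carrier) auto
    moreover have "crt m n (red (m * n) C) = (A, B)"
      using A B C by (simp add: crt_def red_red red_carrier)
    ultimately show ?thesis by blast
  qed
  then have "carrier (SL2_mod m \<times>\<times> SL2_mod n) \<subseteq> crt m n ` carrier (SL2_mod (m * n))"
    unfolding DirProd_def by (simp add: subset_iff image_iff) (metis)
  moreover have "crt m n ` carrier (SL2_mod (m * n)) \<subseteq> carrier (SL2_mod m \<times>\<times> SL2_mod n)"
    using crt_hom [OF assms(2,3)] by (rule hom_carrier)
  ultimately have "bij_betw (crt m n) (carrier (SL2_mod (m * n))) (carrier (SL2_mod m \<times>\<times> SL2_mod n))"
    using crt_inj_on [OF assms(1)] by (simp add: bij_betw_def subset_antisym)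
  with crt_hom [OF assms(2,3)] show ?thesis
    by (simp only: iso_def mem_Collect_eq simp_thms)
qed

subsection \<open>Monoids generated by an upper and a lower elementary matrix\<close>

text \<open>Common form of both monoids: \<open>s = 1\<close>, \<open>t = 4\<close> gives
  \<open>Psi1\<close>, and \<open>s = t = 4\<close> gives \<open>Psi2\<close>.\<close>

definition elem_monoid :: "int \<Rightarrow> int \<Rightarrow> (int^2^2) set" where
  "elem_monoid s t = monoid_gen {mat2 1 s 0 1, mat2 1 0 t 1}"

lemma elem_monoid_mult: "A \<in> elem_monoid s t \<Longrightarrow> B \<in> elem_monoid s t \<Longrightarrow> A ** B \<in> elem_monoid s t"
  by (simp add: elem_monoid_def monoid_gen.mult)

lemma elem_monoid_one: "mat 1 \<in> elem_monoid s t"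
  by (simp add: elem_monoid_def monoid_gen.one)

lemma elem_monoid_upper: "mat2 1 (s * int j) 0 1 \<in> elem_monoid s t"
proof (induction j)
  case 0
  then show ?case by (metis elem_monoid_one mat2_one mult_zero_right of_nat_0)
next
  case (Suc j)
  have "mat2 1 s 0 1 ** mat2 1 (s * int j) 0 1 \<in> elem_monoid s t"
    using Suc by (intro elem_monoid_mult) (auto simp: elem_monoid_def intro: monoid_gen.gen)
  then show ?case by (simp add: mat2_mult algebra_simps)
qed

lemma elem_monoid_lower: "mat2 1 0 (t * int j) 1 \<in> elem_monoid s t"
proof (induction j)
  case 0
  then show ?case by (metis elem_monoid_one mat2_one mult_zero_right of_nat_0)
next
  case (Suc j)
  have "mat2 1 0 t 1 ** mat2 1 0 (t * int j) 1 \<in> elem_monoid s t"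
    using Suc by (intro elem_monoid_mult) (auto simp: elem_monoid_def intro: monoid_gen.gen)
  then show ?case by (simp add: mat2_mult algebra_simps)
qed

lemma elem_monoid_det:
  assumes "A \<in> elem_monoid s t"
  shows "det A = 1"
  using assms unfolding elem_monoid_def
  by (induction rule: monoid_gen.induct) (auto simp: det_mul det_mat2)

text \<open>Necessary conditions for membership; \<open>elem_mod_of_cong\<close> is a partial
  converse modulo \<open>n\<close>. They survive products because an upper off-diagonal entry times
  a lower one is a multiple of \<open>s * t\<close>.\<close>

lemma elem_monoid_cong:
  assumes "mat2 a b c d \<in> elem_monoid s t"
  shows "[a = 1] (mod s * t) \<and> [d = 1] (mod s * t) \<and> s dvd b \<and> t dvd c"
proof -
  have "[A$1$1 = 1] (mod s * t) \<and> [A$2$2 = 1] (mod s * t) \<and> s dvd A$1$2 \<and> t dvd A$2$1"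
    if "A \<in> elem_monoid s t" for A
    using that unfolding elem_monoid_def
  proof (induction rule: monoid_gen.induct)
    case one
    then show ?case by (simp add: mat2_one)
  next
    case (gen A)
    then show ?case by auto
  next
    case (mult A B)
    \<comment> \<open>The shape of both diagonal entries of a product, with \<open>y\<close> an
      upper and \<open>z\<close> a lower off-diagonal entry.\<close>
    have *: "[x * x' + y * z = 1] (mod s * t)"
      if "[x = 1] (mod s * t)" "[x' = 1] (mod s * t)" "s * t dvd y * z" for x x' y z
      using cong_add [OF cong_mult [OF that(1,2)], of "y * z" 0] that(3) by (simp add: cong_0_iff)
    have "s * t dvd A$1$2 * B$2$1" "s * t dvd B$1$2 * A$2$1"
      using mult by (auto intro: mult_dvd_mono)
    then show ?case
      using mult * [of "A$1$1" "B$1$1" "A$1$2" "B$2$1"] * [of "A$2$2" "B$2$2" "B$1$2" "A$2$1"]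
      by (auto simp: matrix_matrix_mult_def sum_2 algebra_simps)
  qed
  from this [OF assms] show ?thesis by simp
qed

text \<open>Membership up to congruence is a predicate on integer matrices, so products can be
  computed over the integers without intermediate reductions.\<close>

definition elem_mod :: "nat \<Rightarrow> int \<Rightarrow> int \<Rightarrow> (int^2^2) set" where
  "elem_mod n s t = {A. red n A \<in> red n ` elem_monoid s t}"

lemma elem_mod_mult:
  assumes "A \<in> elem_mod n s t" "B \<in> elem_mod n s t"
  shows "A ** B \<in> elem_mod n s t"
  using assms red_mult_cong unfolding elem_mod_def by (blast intro: elem_monoid_mult)

lemma elem_mod_cong: "A \<in> elem_mod n s t \<Longrightarrow> red n A = red n B \<Longrightarrow> B \<in> elem_mod n s t"
  by (simp add: elem_mod_def)

text \<open>Here \<open>x\<close> may be negative: the generators have finite order modulo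
  \<open>n\<close>, so the monoid acquires their inverses.\<close>

lemma elem_mod_upper:
  assumes "n > 0" "[y = s * x] (mod int n)"
  shows "mat2 1 y 0 1 \<in> elem_mod n s t"
proof -
  \<comment> \<open>The residue of \<open>x\<close> is a nonnegative exponent with the same effect
    modulo \<open>n\<close>.\<close>
  have "[y = s * int (nat (x mod int n))] (mod int n)"
    using assms by (simp add: cong_def mod_mult_right_eq)
  then have "red n (mat2 1 y 0 1) = red n (mat2 1 (s * int (nat (x mod int n))) 0 1)"
    by (simp add: red_mat2_eq_iff)
  then show ?thesis
    using elem_monoid_upper unfolding elem_mod_def by blast
qed

lemma elem_mod_lower:
  assumes "n > 0" "[y = t * x] (mod int n)"
  shows "mat2 1 0 y 1 \<in> elem_mod n s t"
proof -
  have "[y = t * int (nat (x mod int n))] (mod int n)"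
    using assms by (simp add: cong_def mod_mult_right_eq)
  then have "red n (mat2 1 0 y 1) = red n (mat2 1 0 (t * int (nat (x mod int n))) 1)"
    by (simp add: red_mat2_eq_iff)
  then show ?thesis
    using elem_monoid_lower unfolding elem_mod_def by blast
qed

subsection \<open>Moduli prime to the steps\<close>

text \<open>A unit \<open>s\<close> modulo \<open>n\<close> has every residue among its
  multiples.\<close>

lemma elem_mod_upper_coprime:
  assumes "n > 0" "coprime s (int n)"
  shows "mat2 1 x 0 1 \<in> elem_mod n s t"
proof -
  obtain u where "[s * u = 1] (mod int n)"
    using assms cong_solve_coprime_int by blast
  then have "[x = s * (u * x)] (mod int n)"
    using cong_scalar_right [of "s * u" 1 "int n" x] by (simp add: cong_sym_eq mult.assoc)
  with assms show ?thesis by (blast intro: elem_mod_upper)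
qed

lemma elem_mod_lower_coprime:
  assumes "n > 0" "coprime t (int n)"
  shows "mat2 1 0 x 1 \<in> elem_mod n s t"
proof -
  obtain u where "[t * u = 1] (mod int n)"
    using assms cong_solve_coprime_int by blast
  then have "[x = t * (u * x)] (mod int n)"
    using cong_scalar_right [of "t * u" 1 "int n" x] by (simp add: cong_sym_eq mult.assoc)
  with assms show ?thesis by (blast intro: elem_mod_lower)
qed

text \<open>Euclid's algorithm on the first column, by induction on the size of the lower left
  entry.\<close>

lemma SL2Z_subset_elem_mod:
  assumes n: "n > 0" "coprime s (int n)" "coprime t (int n)"
  shows "SL2Z \<subseteq> elem_mod n s t"
proof -
  note U = elem_mod_upper_coprime [OF n(1,2), of _ t]
  note L = elem_mod_lower_coprime [OF n(1,3), of _ s]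
  \<comment> \<open>The Weyl element as upper times lower times upper, with entries 1, -1, 1. Its
    square \<open>neg\<close> handles the terminal case \<open>a = d = - 1\<close>.\<close>
  have S: "mat2 0 1 (- 1) 0 \<in> elem_mod n s t"
    using elem_mod_mult [OF elem_mod_mult [OF U L] U, of 1 "- 1" 1] by (simp add: mat2_mult)
  have neg: "mat2 (- 1) 0 0 (- 1) \<in> elem_mod n s t"
    using elem_mod_mult [OF S S] by (simp add: mat2_mult)
  have "mat2 a b c d \<in> elem_mod n s t" if "a * d - b * c = 1" for a b c d
    using that
  proof (induction "nat \<bar>c\<bar>" arbitrary: a b c d rule: less_induct)
    case less
    show ?case
    proof (cases "c = 0")
      case True
      then have "a = 1 \<and> d = 1 \<or> a = - 1 \<and> d = - 1"
        using less.prems by (simp add: zmult_eq_1_iff)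
      then show ?thesis
        using U [of b] elem_mod_mult [OF neg U, of "- b"] True by (auto simp: mat2_mult)
    next
      case False
      define q where "q = a div c"
      define r where "r = a mod c"
      have a: "a = q * c + r" by (simp add: q_def r_def)
      have "\<bar>r\<bar> < \<bar>c\<bar>"
        using False by (simp add: r_def abs_mod_less)
      \<comment> \<open>Multiplying this matrix on the left by the Weyl element gives rows
        \<open>(r, b - q * d)\<close> and \<open>(c, d)\<close>; adding \<open>q\<close> times the
        second row to the first restores \<open>a\<close> and \<open>b\<close>.\<close>
      then have "mat2 (- c) (- d) r (b - q * d) \<in> elem_mod n s t"
        using less.prems by (intro less.hyps) (auto simp: a algebra_simps)
      from elem_mod_mult [OF U elem_mod_mult [OF S this], of q]
      show ?thesis by (simp add: mat2_mult a algebra_simps)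
    qed
  qed
  then have "A \<in> elem_mod n s t" if "det A = 1" for A
    using that by (cases A rule: mat2_cases) (simp add: det_mat2)
  then show ?thesis
    by (auto simp: SL2Z_def)
qed

lemma red_elem_monoid_coprime:
  assumes "n > 0" "coprime s (int n)" "coprime t (int n)"
  shows "red n ` elem_monoid s t = red n ` SL2Z"
proof
  show "red n ` elem_monoid s t \<subseteq> red n ` SL2Z"
    by (auto simp: SL2Z_def elem_monoid_det)
  show "red n ` SL2Z \<subseteq> red n ` elem_monoid s t"
    using SL2Z_subset_elem_mod [OF assms] by (auto simp: elem_mod_def)
qed

subsection \<open>Splitting the image over coprime moduli\<close>

text \<open>Surjectivity of the Chinese remainder map rests on this: each generator in a word for
  \<open>A\<close> is replaced by its \<open>j\<close>-th power, where \<open>j\<close> is 1 modulo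
  \<open>m\<close> and 0 modulo \<open>n\<close>.\<close>

lemma elem_monoid_separate:
  assumes "coprime m n" "A \<in> elem_monoid s t"
  shows "\<exists>C \<in> elem_monoid s t. red m C = red m A \<and> red n C = red n (mat 1)"
proof -
  obtain j where "[j = 1] (mod m)" "[j = 0] (mod n)"
    using binary_chinese_remainder_nat [OF assms(1)] by blast
  then have j: "[int j = 1] (mod int m)" "[int j = 0] (mod int n)"
    by (metis cong_int_iff of_nat_1, metis cong_int_iff of_nat_0)
  have j': "[u * int j = u] (mod int m)" "[u * int j = 0] (mod int n)" for u
    using cong_scalar_left [OF j(1), of u] cong_scalar_left [OF j(2), of u] by auto
  show ?thesis
    using assms(2) unfolding elem_monoid_def
  proof (induction rule: monoid_gen.induct)
    case one
    then show ?case using monoid_gen.one by blast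
  next
    case (gen A)
    then consider "A = mat2 1 s 0 1" | "A = mat2 1 0 t 1" by blast
    then show ?case
    proof cases
      case 1
      with j' elem_monoid_upper [of s j t] show ?thesis
        by (intro bexI [of _ "mat2 1 (s * int j) 0 1"])
          (auto simp: red_mat2_eq_iff mat2_one elem_monoid_def)
    next
      case 2
      with j' elem_monoid_lower [of t j s] show ?thesis
        by (intro bexI [of _ "mat2 1 0 (t * int j) 1"])
          (auto simp: red_mat2_eq_iff mat2_one elem_monoid_def)
    qed
  next
    case (mult A B)
    then obtain C D where
      "C \<in> monoid_gen {mat2 1 s 0 1, mat2 1 0 t 1}" "red m C = red m A" "red n C = red n (mat 1)"
      "D \<in> monoid_gen {mat2 1 s 0 1, mat2 1 0 t 1}" "red m D = red m B" "red n D = red n (mat 1)"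
      by blast
    then show ?case
      using red_mult_cong [of n C "mat 1" D "mat 1"]
      by (intro bexI [of _ "C ** D"]) (auto intro: red_mult_cong monoid_gen.mult)
  qed
qed

lemma crt_iso_elem_monoid:
  assumes "coprime m n" "m > 0" "n > 0"
  shows "crt m n \<in> iso (image_mod (elem_monoid s t) (m * n))
           (image_mod (elem_monoid s t) m \<times>\<times> image_mod (elem_monoid s t) n)"
proof -
  let ?E = "elem_monoid s t"
  have sub: "red k ` ?E \<subseteq> carrier (SL2_mod k)" if "k > 0" for k
    using that by (auto intro!: red_in_carrier simp: elem_monoid_det)
  have maps: "crt m n ` red (m * n) ` ?E \<subseteq> red m ` ?E \<times> red n ` ?E"
    by (auto simp: crt_def red_red)
  have "(red m A, red n B) \<in> crt m n ` red (m * n) ` ?E" if A: "A \<in> ?E" and B: "B \<in> ?E" for A B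
  proof -
    have "coprime n m"
      using assms(1) by (simp add: coprime_commute)
    then obtain C D where CD: "C \<in> ?E" "red m C = red m A" "red n C = red n (mat 1)"
      "D \<in> ?E" "red n D = red n B" "red m D = red m (mat 1)"
      using elem_monoid_separate [OF assms(1) A] elem_monoid_separate [OF _ B] by blast
    \<comment> \<open>\<open>D\<close> is trivial modulo \<open>m\<close> and \<open>C\<close> is
      trivial modulo \<open>n\<close>, so each factor of the product controls one modulus.\<close>
    then have "red m (C ** D) = red m A" "red n (C ** D) = red n B"
      using red_mult_cong [of m C A D "mat 1"] red_mult_cong [of n C "mat 1" D B] by simp_all
    then have "crt m n (red (m * n) (C ** D)) = (red m A, red n B)"
      by (simp add: crt_def red_red)
    then show ?thesis
      using elem_monoid_mult CD(1,4) by (metis imageI)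
  qed
  then have surj: "crt m n ` red (m * n) ` ?E = red m ` ?E \<times> red n ` ?E"
    using maps by blast
  have "inj_on (crt m n) (red (m * n) ` ?E)"
    using crt_inj_on [OF assms(1)] sub assms by (metis inj_on_subset nat_0_less_mult_iff)
  then have bij: "bij_betw (crt m n) (red (m * n) ` ?E) (red m ` ?E \<times> red n ` ?E)"
    using surj by (simp add: bij_betw_def)
  have "crt m n \<in> hom (image_mod ?E (m * n)) (image_mod ?E m \<times>\<times> image_mod ?E n)"
  proof (rule homI)
    fix A assume "A \<in> carrier (image_mod ?E (m * n))"
    then show "crt m n A \<in> carrier (image_mod ?E m \<times>\<times> image_mod ?E n)"
      using maps by (auto simp: image_mod_def)
  next
    fix A B
    show "crt m n (A \<otimes>\<^bsub>image_mod ?E (m * n)\<^esub> B) =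
          crt m n A \<otimes>\<^bsub>image_mod ?E m \<times>\<times> image_mod ?E n\<^esub> crt m n B"
      by (simp add: crt_def image_mod_def SL2_mod_def red_red red_mult_red)
  qed
  then show ?thesis
    using bij by (simp add: iso_def image_mod_def)
qed

subsection \<open>Congruence conditions that characterise the image\<close>

text \<open>Since \<open>a\<close> is a unit modulo \<open>n\<close>, the determinant condition
  fixes \<open>d\<close>; it suffices to realise \<open>a\<close>, \<open>b\<close> and
  \<open>c\<close>.\<close>

lemma elem_mod_of_cong:
  assumes n: "n > 0" and a: "[a = 1] (mod s * t)" and b: "s dvd b" and c: "t dvd c"
    and det: "[a * d - b * c = 1] (mod int n)" and cop: "coprime a (int n)"
  shows "mat2 a b c d \<in> elem_mod n s t"
proof -
  obtain m where m: "a = 1 + s * t * m"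
    using a by (metis add.commute cong_iff_dvd_diff diff_add_cancel dvdE)
  obtain b' c' where b': "b = s * b'" and c': "c = t * c'"
    using b c by (meson dvdE)
  obtain u where u: "[a * u = 1] (mod int n)"
    using cop cong_solve_coprime_int by blast
  have solve: "[x + a * (u * (y - x)) = y] (mod int n)" for x y
    using cong_add [OF cong_refl [of x] cong_scalar_right [OF u, of "y - x"]]
    by (simp add: mult.assoc)
  \<comment> \<open>With \<open>u\<close> inverse to \<open>a\<close>, these solve
    \<open>m + a * p = c'\<close> and \<open>1 + a * q = b'\<close> modulo \<open>n\<close>;
    \<open>e\<close> is the lower right entry of the product below.\<close>
  define p where "p = u * (c' - m)"
  define q where "q = u * (b' - 1)"
  define e where "e = (1 + t * p * s) + (t * m + t * p * a) * (s * q)"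
  \<comment> \<open>The middle pair has upper left entry \<open>1 + s * t * m = a\<close>. The outer
    factors keep it and add multiples of \<open>a\<close> to the off-diagonal entries.\<close>
  have "mat2 1 0 (t * p) 1 ** (mat2 1 (s * 1) 0 1 ** mat2 1 0 (t * m) 1) ** mat2 1 (s * q) 0 1
        \<in> elem_mod n s t"
    by (intro elem_mod_mult elem_mod_upper [OF n cong_refl] elem_mod_lower [OF n cong_refl])
  also have "mat2 1 0 (t * p) 1 ** (mat2 1 (s * 1) 0 1 ** mat2 1 0 (t * m) 1) ** mat2 1 (s * q) 0 1
        = mat2 a (s * (1 + a * q)) (t * (m + a * p)) e"
    by (simp add: mat2_mult m e_def algebra_simps)
  finally have mem: "mat2 a (s * (1 + a * q)) (t * (m + a * p)) e \<in> elem_mod n s t" .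
  have B: "[s * (1 + a * q) = b] (mod int n)" and C: "[t * (m + a * p) = c] (mod int n)"
    unfolding b' c' p_def q_def by (intro cong_scalar_left solve)+
  \<comment> \<open>The product has determinant 1; comparison with \<open>det\<close> and
    cancellation of the unit \<open>a\<close> give \<open>e = d\<close> modulo
    \<open>n\<close>.\<close>
  have "a * e = 1 + s * (1 + a * q) * (t * (m + a * p))"
    unfolding e_def m by algebra
  also have "[1 + s * (1 + a * q) * (t * (m + a * p)) = 1 + b * c] (mod int n)"
    by (intro cong_add cong_mult B C cong_refl)
  also have "[1 + b * c = a * d] (mod int n)"
    using cong_add [OF cong_sym [OF det] cong_refl [of "b * c"]] by simp
  finally have "[e = d] (mod int n)"
    using cop by (simp add: cong_mult_lcancel)
  with B C show ?thesis
    by (intro elem_mod_cong [OF mem]) (simp add: red_mat2_eq_iff)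
qed

text \<open>The congruence conditions are visible modulo \<open>s * t\<close>, hence modulo
  \<open>2 ^ e\<close>. Evenness of \<open>s * t\<close> forces \<open>a\<close> to be odd, so it is
  a unit modulo every \<open>2 ^ k\<close>.\<close>

lemma full_preimage_elem_monoid:
  assumes st: "s * t dvd 2 ^ e" and even: "even (s * t)"
  shows "full_preimage_from (elem_monoid s t) e"
  unfolding full_preimage_from_def
proof (intro allI impI subset_antisym subsetI)
  fix k A
  assume k: "e \<le> k" and A: "A \<in> red (2 ^ k) ` elem_monoid s t"
  then show "A \<in> {A \<in> carrier (SL2_mod (2 ^ k)). red (2 ^ e) A \<in> red (2 ^ e) ` elem_monoid s t}"
    by (auto simp: elem_monoid_det red_red le_imp_power_dvd intro!: red_in_carrier)
next
  fix k A
  assume k: "e \<le> k"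
    and A: "A \<in> {A \<in> carrier (SL2_mod (2 ^ k)). red (2 ^ e) A \<in> red (2 ^ e) ` elem_monoid s t}"
  then obtain P where P: "P \<in> elem_monoid s t" "red (2 ^ e) A = red (2 ^ e) P" by auto
  obtain a b c d where abcd: "A = mat2 a b c d" by (rule mat2_cases)
  obtain a' b' c' d' where abcd': "P = mat2 a' b' c' d'" by (rule mat2_cases)
  have P': "[a' = 1] (mod s * t)" "s dvd b'" "t dvd c'"
    using elem_monoid_cong P(1) unfolding abcd' by blast+
  have "[a = a'] (mod 2 ^ e)" "[b = b'] (mod 2 ^ e)" "[c = c'] (mod 2 ^ e)"
    using P(2) by (simp_all add: abcd abcd' red_mat2_eq_iff)
  then have eq: "[a = a'] (mod s * t)" "[b = b'] (mod s)" "[c = c'] (mod t)"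
    using st by (meson cong_dvd_modulus dvd_mult_left dvd_mult_right)+
  have a: "[a = 1] (mod s * t)"
    using eq(1) P'(1) by (rule cong_trans)
  have "odd a"
    using cong_dvd_modulus [OF a even] by (simp add: cong_def odd_iff_mod_2_eq_one)
  moreover have "s dvd b" "t dvd c"
    using eq P' cong_dvd_iff by blast+
  moreover have "[a * d - b * c = 1] (mod int (2 ^ k))"
    using A by (simp add: carrier_SL2_mod_iff abcd det_mat2)
  ultimately have "A \<in> elem_mod (2 ^ k) s t"
    unfolding abcd using a by (intro elem_mod_of_cong) auto
  then show "A \<in> red (2 ^ k) ` elem_monoid s t"
    using A red_carrier by (auto simp: elem_mod_def)
qed

theorem theorem7p1:
  shows "(\<forall>\<Psi>\<in>{Psi1, Psi2}.
            (\<forall>n nodd n' :: nat.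
               n > 0 \<and> n = nodd * n' \<and> odd nodd \<and> (\<exists>r::nat. n' = 2 ^ r) \<longrightarrow>
                 crt nodd n' \<in> iso (SL2_mod n) (SL2_mod nodd \<times>\<times> SL2_mod n') \<and>
                 crt nodd n' \<in> iso (image_mod \<Psi> n) (image_mod \<Psi> nodd \<times>\<times> image_mod \<Psi> n') \<and>
                 red nodd ` \<Psi> = red nodd ` SL2Z) \<and>
            (\<exists>e\<ge>1. full_preimage_from \<Psi> e)) \<and>
         full_preimage_from Psi1 2 \<and> full_preimage_from Psi2 4"
proof -
  have Psi: "Psi1 = elem_monoid 1 4" "Psi2 = elem_monoid 4 4"
    by (simp_all add: Psi1_def Psi2_def elem_monoid_def)
  \<comment> \<open>The exponents come from \<open>s * t\<close>: \<open>1 * 4 = 2 ^ 2\<close> and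
    \<open>4 * 4 = 2 ^ 4\<close>.\<close>
  have pre: "full_preimage_from Psi1 2" "full_preimage_from Psi2 4"
    unfolding Psi by (auto intro!: full_preimage_elem_monoid)
  have main: "crt nodd n' \<in> iso (SL2_mod n) (SL2_mod nodd \<times>\<times> SL2_mod n') \<and>
      crt nodd n' \<in> iso (image_mod \<Psi> n) (image_mod \<Psi> nodd \<times>\<times> image_mod \<Psi> n') \<and>
      red nodd ` \<Psi> = red nodd ` SL2Z"
    if \<Psi>: "\<Psi> \<in> {Psi1, Psi2}" and n: "n > 0" "n = nodd * n'" "odd nodd" "n' = 2 ^ r"
    for \<Psi> and n nodd n' r :: nat
  proof -
    obtain s where s: "\<Psi> = elem_monoid s 4" "s = 1 \<or> s = 4"
      using \<Psi> Psi by blast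
    have pos: "nodd > 0" "n' > 0" and cop: "coprime nodd n'"
      using n by auto
    have "coprime (2 ^ 2) (int nodd)"
      using n(3) by (subst coprime_power_left_iff) auto
    then have "coprime 4 (int nodd)" "coprime s (int nodd)"
      using s(2) by auto
    then show ?thesis
      unfolding s(1) n(2)
      using pos cop crt_iso crt_iso_elem_monoid red_elem_monoid_coprime by blast
  qed
  have "\<exists>e\<ge>1. full_preimage_from \<Psi> e" if "\<Psi> \<in> {Psi1, Psi2}" for \<Psi>
    using that pre by (auto intro: exI [of _ 2] exI [of _ 4])
  moreover have "\<forall>n nodd n' :: nat.
      n > 0 \<and> n = nodd * n' \<and> odd nodd \<and> (\<exists>r::nat. n' = 2 ^ r) \<longrightarrow>
        crt nodd n' \<in> iso (SL2_mod n) (SL2_mod nodd \<times>\<times> SL2_mod n') \<and>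
        crt nodd n' \<in> iso (image_mod \<Psi> n) (image_mod \<Psi> nodd \<times>\<times> image_mod \<Psi> n') \<and>
        red nodd ` \<Psi> = red nodd ` SL2Z" if "\<Psi> \<in> {Psi1, Psi2}" for \<Psi>
    by (intro allI impI, elim conjE exE) (rule main [OF that])
  ultimately show ?thesis
    by (intro conjI ballI pre)
qed

end
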